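(* For every integer $n$ (with $n\ge 0$), $GL_n(B_1)\simeq\Sigma_n$, where $GL_n(B_1)$ is the group of automorphisms of a free $B_1$-module of rank $n$ and $\Sigma_n$ is the symmetric group on $n$ letters.
   Context: $B_1=\{0,1\}$ with addition $0+0=0$, $0+1=1+0=1+1=1$ and the usual multiplication. A $B_1$-module is a commutative monoid $(M,+)$ with neutral element $0$ together with a map $B_1\times M\to M$, $(\lambda,x)\mapsto\lambda x$, such that $(\lambda+\mu)x=\lambda x+\mu x$, $\lambda(x+y)=\lambda x+\lambda y$, $1x=x$, $0x=0$; morphisms are the maps preserving $+$ and the external law. A free $B_1$-module of rank $n$ is a free $B_1$-module generated by a set $A$ with $n$ elements, in the sense of the usual universal property; a model is the set $\mathcal{P}(A)$ of subsets of $A$ with addition $\cup$, zero element $\emptyset$, and generators the singletons $\{a\}$, $a\in A$. *)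

theory Defs
  imports "HOL-Algebra.Bij" "HOL-Algebra.Module" "HOL-Algebra.Sym_Groups"
begin

section \<open>The semiring \<open>B\<^sub>1\<close>\<close>

datatype B1 = B1_zero | B1_one

instantiation B1 :: comm_semiring_1
begin

definition zero_B1 :: B1 where "0 = B1_zero"

definition one_B1 :: B1 where "1 = B1_one"

fun plus_B1 :: "B1 \<Rightarrow> B1 \<Rightarrow> B1" where
  "B1_zero + B1_zero = B1_zero"
| "B1_zero + B1_one = B1_one"
| "B1_one + B1_zero = B1_one"
| "B1_one + B1_one = B1_one"

fun times_B1 :: "B1 \<Rightarrow> B1 \<Rightarrow> B1" where
  "B1_zero * B1_zero = B1_zero"
| "B1_zero * B1_one = B1_zero"
| "B1_one * B1_zero = B1_zero"
| "B1_one * B1_one = B1_one"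

instance
proof
  fix a b c :: B1
  show "a * b * c = a * (b * c)" by (cases a; cases b; cases c) simp_all
  show "a * b = b * a" by (cases a; cases b) simp_all
  show "1 * a = a" by (cases a) (simp_all add: one_B1_def)
  show "a + b + c = a + (b + c)" by (cases a; cases b; cases c) simp_all
  show "a + b = b + a" by (cases a; cases b) simp_all
  show "0 + a = a" by (cases a) (simp_all add: zero_B1_def)
  show "(a + b) * c = a * c + b * c" by (cases a; cases b; cases c) simp_all
  show "0 * a = 0" by (cases a) (simp_all add: zero_B1_def)
  show "a * 0 = 0" by (cases a) (simp_all add: zero_B1_def)
  show "(0::B1) \<noteq> 1" by (simp add: zero_B1_def one_B1_def)
qed

end

lemma B1_cases: "l = 0 \<or> l = (1::B1)"
  by (cases l) (simp_all add: zero_B1_def one_B1_def)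

lemma B1_two: "2 = (1::B1)"
proof -
  have "(2::B1) = 1 + 1" by simp
  also have "\<dots> = 1" unfolding one_B1_def by simp
  finally show ?thesis .
qed


section \<open>\<open>B\<^sub>1\<close>-modules and their morphisms\<close>

text \<open>
  Modules are instances of the record type \<^typ>\<open>(B1, 'm) module\<close>; as in \<open>HOL-Algebra\<close>,
  its fields \<open>mult\<close> and \<open>one\<close> are irrelevant. The locale \<open>module\<close> itself is not
  applicable, because it requires a ring of scalars and additive inverses.
\<close>

locale B1_module = abelian_monoid M for M :: "(B1, 'm) module" (structure) +
  assumes smult_closed: "x \<in> carrier M \<Longrightarrow> l \<odot> x \<in> carrier M"
    and smult_l_distr: "x \<in> carrier M \<Longrightarrow> (l + k) \<odot> x = l \<odot> x \<oplus> k \<odot> x"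
    and smult_r_distr: "x \<in> carrier M \<Longrightarrow> y \<in> carrier M \<Longrightarrow> l \<odot> (x \<oplus> y) = l \<odot> x \<oplus> l \<odot> y"
    and smult_one: "x \<in> carrier M \<Longrightarrow> 1 \<odot> x = x"
    and smult_zero: "x \<in> carrier M \<Longrightarrow> 0 \<odot> x = \<zero>"

text \<open>
  Morphisms are extensional functions, so that equality of morphisms is equality of their
  values on the carrier. They preserve \<open>\<zero>\<close> because \<open>\<zero>\<close> is \<open>0 \<odot> x\<close>.
\<close>

definition B1_hom :: "(B1, 'm) module \<Rightarrow> (B1, 'b) module \<Rightarrow> ('m \<Rightarrow> 'b) set" where
  "B1_hom M N = {f \<in> carrier M \<rightarrow>\<^sub>E carrier N.
     (\<forall>x\<in>carrier M. \<forall>y\<in>carrier M. f (x \<oplus>\<^bsub>M\<^esub> y) = f x \<oplus>\<^bsub>N\<^esub> f y) \<and>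
     (\<forall>l. \<forall>x\<in>carrier M. f (l \<odot>\<^bsub>M\<^esub> x) = l \<odot>\<^bsub>N\<^esub> f x)}"

definition B1_Aut :: "(B1, 'm) module \<Rightarrow> ('m \<Rightarrow> 'm) monoid" where
  "B1_Aut M = BijGroup (carrier M) \<lparr>carrier := B1_hom M M \<inter> Bij (carrier M)\<rparr>"


section \<open>Free \<open>B\<^sub>1\<close>-modules\<close>

text \<open>
  The universal property of \<open>\<iota> : A \<rightarrow> M\<close>, tested on the \<open>B\<^sub>1\<close>-modules with elements in a
  given type \<^typ>\<open>'b\<close>.
\<close>

definition B1_free_wrt ::
    "'b itself \<Rightarrow> (B1, 'm) module \<Rightarrow> 'a set \<Rightarrow> ('a \<Rightarrow> 'm) \<Rightarrow> bool" where
  "B1_free_wrt _ M A \<iota> \<longleftrightarrow>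
     B1_module M \<and> \<iota> \<in> A \<rightarrow> carrier M \<and>
     (\<forall>N :: (B1, 'b) module. B1_module N \<longrightarrow>
        (\<forall>g \<in> A \<rightarrow> carrier N. \<exists>!f. f \<in> B1_hom M N \<and> (\<forall>a\<in>A. f (\<iota> a) = g a)))"

text \<open>
  A formula of HOL cannot quantify over types, so a type of test modules has to be chosen. The
  type \<open>'a set + 'm\<close> has room for a copy of \<open>\<P>(A)\<close> and for a copy of \<open>M\<close>. For finite \<open>A\<close>
  this suffices: theorem \<open>B1_free_wrt_any_type\<close> below derives the universal property
  for test modules of every type.
\<close>

definition B1_free :: "(B1, 'm) module \<Rightarrow> 'a set \<Rightarrow> ('a \<Rightarrow> 'm) \<Rightarrow> bool" where
  "B1_free M A \<iota> \<longleftrightarrow> B1_free_wrt TYPE('a set + 'm) M A \<iota>"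

definition B1_Pow :: "'a set \<Rightarrow> (B1, 'a set) module" where
  "B1_Pow A = \<lparr>carrier = Pow A, monoid.mult = undefined, one = undefined,
     zero = {}, add = (\<union>), smult = (\<lambda>l X. if l = 0 then {} else X)\<rparr>"


subsection \<open>The automorphisms form a group\<close>

lemma B1_hom_id: "B1_module M \<Longrightarrow> (\<lambda>x\<in>carrier M. x) \<in> B1_hom M M"
proof -
  assume "B1_module M"
  then interpret B1_module M .
  show ?thesis by (auto simp: B1_hom_def smult_closed)
qed

lemma B1_hom_compose:
  assumes M: "B1_module M" and f: "f \<in> B1_hom M N" and g: "g \<in> B1_hom N P"
  shows "compose (carrier M) g f \<in> B1_hom M P"
proof -
  interpret B1_module M by fact
  have fc: "x \<in> carrier M \<Longrightarrow> f x \<in> carrier N" for x using f by (auto simp: B1_hom_def)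
  show ?thesis using f g fc
    by (auto simp: B1_hom_def compose_def smult_closed PiE_iff)
qed

theorem group_B1_Aut:
  assumes "B1_module M"
  shows "group (B1_Aut M)"
proof -
  interpret B1_module M by fact
  have "subgroup (B1_hom M M \<inter> Bij (carrier M)) (BijGroup (carrier M))"
  proof (rule subgroup.intro)
    show "B1_hom M M \<inter> Bij (carrier M) \<subseteq> carrier (BijGroup (carrier M))"
      by (simp add: BijGroup_def)
    show "\<one>\<^bsub>BijGroup (carrier M)\<^esub> \<in> B1_hom M M \<inter> Bij (carrier M)"
      using B1_hom_id[OF assms] by (simp add: BijGroup_def id_Bij)
  next
    fix f g
    assume "f \<in> B1_hom M M \<inter> Bij (carrier M)" "g \<in> B1_hom M M \<inter> Bij (carrier M)"
    then show "f \<otimes>\<^bsub>BijGroup (carrier M)\<^esub> g \<in> B1_hom M M \<inter> Bij (carrier M)"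
      using B1_hom_compose[OF assms, of g M f M] by (simp add: BijGroup_def compose_Bij)
  next
    fix f
    assume f: "f \<in> B1_hom M M \<inter> Bij (carrier M)"
    let ?h = "inv_into (carrier M) f"
    have bij: "bij_betw f (carrier M) (carrier M)" using f by (simp add: Bij_def)
    have hc: "x \<in> carrier M \<Longrightarrow> ?h x \<in> carrier M" for x
      using f by (simp add: Bij_inv_into_mem)
    have fh: "x \<in> carrier M \<Longrightarrow> f (?h x) = x" for x
      using bij by (simp add: bij_betw_inv_into_right)
    have hf: "x \<in> carrier M \<Longrightarrow> ?h (f x) = x" for x
      using bij by (simp add: bij_betw_inv_into_left)
    have add: "?h (x \<oplus>\<^bsub>M\<^esub> y) = ?h x \<oplus>\<^bsub>M\<^esub> ?h y" if "x \<in> carrier M" "y \<in> carrier M" for x y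
    proof -
      have "f (?h x \<oplus>\<^bsub>M\<^esub> ?h y) = x \<oplus>\<^bsub>M\<^esub> y" using f that hc fh by (auto simp: B1_hom_def)
      then show ?thesis using hf[of "?h x \<oplus>\<^bsub>M\<^esub> ?h y"] that hc by simp
    qed
    have smult: "?h (l \<odot>\<^bsub>M\<^esub> x) = l \<odot>\<^bsub>M\<^esub> ?h x" if "x \<in> carrier M" for l x
    proof -
      have "f (l \<odot>\<^bsub>M\<^esub> ?h x) = l \<odot>\<^bsub>M\<^esub> x" using f that hc fh by (auto simp: B1_hom_def)
      then show ?thesis using hf[of "l \<odot>\<^bsub>M\<^esub> ?h x"] that hc smult_closed by simp
    qed
    have "restrict ?h (carrier M) \<in> B1_hom M M"
      using hc add smult smult_closed by (auto simp: B1_hom_def)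
    then show "inv\<^bsub>BijGroup (carrier M)\<^esub> f \<in> B1_hom M M \<inter> Bij (carrier M)"
      using f by (simp add: inv_BijGroup restrict_inv_into_Bij del: restrict_apply)
  qed
  then show ?thesis
    unfolding B1_Aut_def by (rule subgroup.subgroup_is_group[OF _ group_BijGroup])
qed


subsection \<open>The model \<open>\<P>(A)\<close>\<close>

lemma B1_module_Pow: "B1_module (B1_Pow A)"
proof (intro B1_module.intro B1_module_axioms.intro abelian_monoidI)
  fix l k :: B1 and X
  show "(l + k) \<odot>\<^bsub>B1_Pow A\<^esub> X = l \<odot>\<^bsub>B1_Pow A\<^esub> X \<oplus>\<^bsub>B1_Pow A\<^esub> k \<odot>\<^bsub>B1_Pow A\<^esub> X"
    using B1_cases[of l] B1_cases[of k] by (auto simp: B1_Pow_def B1_two)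
qed (auto simp: B1_Pow_def)

context B1_module
begin

lemma add_idem: "x \<in> carrier M \<Longrightarrow> x \<oplus> x = x"
  using smult_l_distr[of x 1 1] by (simp add: B1_two smult_one)

lemma finsum_insert_idem:
  assumes "finite X" "g \<in> insert b X \<rightarrow> carrier M"
  shows "finsum M g (insert b X) = g b \<oplus> finsum M g X"
proof (cases "b \<in> X")
  case True
  then have X: "X = insert b (X - {b})" by auto
  have gb: "g b \<in> carrier M" and g': "g \<in> X - {b} \<rightarrow> carrier M" using assms by auto
  have s: "finsum M g X = g b \<oplus> finsum M g (X - {b})"
    by (subst X, rule finsum_insert) (use assms gb g' in auto)
  have "g b \<oplus> finsum M g X = (g b \<oplus> g b) \<oplus> finsum M g (X - {b})"
    using s gb finsum_closed[OF g'] by (simp add: a_assoc)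
  then show ?thesis using True s gb by (simp add: add_idem insert_absorb)
next
  case False
  then show ?thesis using assms by (simp add: finsum_insert Pi_iff)
qed

lemma finsum_Un_idem:
  assumes "finite X" "finite Y" "g \<in> X \<union> Y \<rightarrow> carrier M"
  shows "finsum M g (X \<union> Y) = finsum M g X \<oplus> finsum M g Y"
  using assms
proof (induction X rule: finite_induct)
  case empty
  then show ?case by (simp add: finsum_closed)
next
  case (insert b X)
  then have c: "g b \<in> carrier M" "g \<in> X \<rightarrow> carrier M" "g \<in> Y \<rightarrow> carrier M" by auto
  have "finsum M g (insert b (X \<union> Y)) = g b \<oplus> finsum M g (X \<union> Y)"
    using insert c by (intro finsum_insert_idem) auto
  then show ?case
    using insert c by (simp add: finsum_insert finsum_closed a_assoc)
qed

end

theorem B1_free_wrt_Pow: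
  assumes A: "finite A"
  shows "B1_free_wrt TYPE('b) (B1_Pow A) A (\<lambda>a. {a})"
  unfolding B1_free_wrt_def
proof (intro conjI allI impI ballI)
  show "B1_module (B1_Pow A)" by (rule B1_module_Pow)
  show "(\<lambda>a. {a}) \<in> A \<rightarrow> carrier (B1_Pow A)" by (auto simp: B1_Pow_def)
  fix N :: "(B1, 'b) module" and g
  assume "B1_module N" and g: "g \<in> A \<rightarrow> carrier N"
  then interpret N: B1_module N by simp
  have gX: "g \<in> X \<rightarrow> carrier N" if "X \<subseteq> A" for X using g that by auto
  have fin: "finite X" if "X \<subseteq> A" for X using that A finite_subset by auto
  let ?f = "\<lambda>X\<in>Pow A. finsum N g X"
  show "\<exists>!f. f \<in> B1_hom (B1_Pow A) N \<and> (\<forall>a\<in>A. f {a} = g a)"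
  proof (rule ex1I[of _ ?f], intro conjI ballI)
    have "finsum N g (if l = 0 then {} else X) = l \<odot>\<^bsub>N\<^esub> finsum N g X" if "X \<subseteq> A" for l X
      using B1_cases[of l] N.finsum_closed[OF gX[OF that]]
      by (auto simp: N.smult_one N.smult_zero)
    moreover have "finsum N g (X \<union> Y) = finsum N g X \<oplus>\<^bsub>N\<^esub> finsum N g Y"
      if "X \<subseteq> A" "Y \<subseteq> A" for X Y
      using that by (intro N.finsum_Un_idem fin gX) auto
    ultimately show "?f \<in> B1_hom (B1_Pow A) N"
      using N.finsum_closed gX by (auto simp: B1_hom_def B1_Pow_def)
    show "?f {a} = g a" if "a \<in> A" for a
      using that g N.finsum_insert[of "{}" a g] by (auto simp: Pi_iff)
  next
    fix f
    assume f: "f \<in> B1_hom (B1_Pow A) N \<and> (\<forall>a\<in>A. f {a} = g a)"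
    have un: "f (X \<union> Y) = f X \<oplus>\<^bsub>N\<^esub> f Y" if "X \<subseteq> A" "Y \<subseteq> A" for X Y
      using f that by (auto simp: B1_hom_def B1_Pow_def)
    have sm: "\<And>l X. X \<subseteq> A \<Longrightarrow> f (if l = 0 then {} else X) = l \<odot>\<^bsub>N\<^esub> f X"
      and ext: "f \<in> extensional (Pow A)" and fc: "\<And>X. X \<subseteq> A \<Longrightarrow> f X \<in> carrier N"
      using f by (auto simp: B1_hom_def B1_Pow_def PiE_def)
    have e: "f {} = \<zero>\<^bsub>N\<^esub>" using sm[of "{}" 0] fc[of "{}"] by (simp add: N.smult_zero)
    have "f X = finsum N g X" if "X \<subseteq> A" for X
      using fin[OF that] that
    proof (induction X rule: finite_induct)
      case (insert a X)
      then have "f (insert a X) = g a \<oplus>\<^bsub>N\<^esub> finsum N g X"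
        using un[of "{a}" X] f by simp
      also have "\<dots> = finsum N g (insert a X)"
        using insert g by (subst N.finsum_insert) auto
      finally show ?case .
    qed (simp add: e)
    then show "f = ?f" using ext by (auto simp: extensional_def fun_eq_iff)
  qed
qed


subsection \<open>Independence of the type of test modules\<close>

lemma B1_free_wrt_ex1:
  fixes N :: "(B1, 'b) module"
  assumes "B1_free_wrt TYPE('b) M A \<iota>" "B1_module N" "g \<in> A \<rightarrow> carrier N"
  shows "\<exists>!f. f \<in> B1_hom M N \<and> (\<forall>a\<in>A. f (\<iota> a) = g a)"
  using assms(1)[unfolded B1_free_wrt_def, THEN conjunct2, THEN conjunct2, rule_format, OF assms(2,3)] .

lemma B1_free_wrtD:
  fixes N :: "(B1, 'b) module"
  assumes "B1_free_wrt TYPE('b) M A \<iota>" "B1_module N" "g \<in> A \<rightarrow> carrier N"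
  shows "\<exists>f \<in> B1_hom M N. \<forall>a\<in>A. f (\<iota> a) = g a"
    and "\<And>f f'. f \<in> B1_hom M N \<Longrightarrow> f' \<in> B1_hom M N \<Longrightarrow> \<forall>a\<in>A. f (\<iota> a) = g a \<Longrightarrow>
      \<forall>a\<in>A. f' (\<iota> a) = g a \<Longrightarrow> f = f'"
proof -
  have "\<exists>!f. f \<in> B1_hom M N \<and> (\<forall>a\<in>A. f (\<iota> a) = g a)"
    by (rule B1_free_wrt_ex1[OF assms])
  then show "\<exists>f \<in> B1_hom M N. \<forall>a\<in>A. f (\<iota> a) = g a"
    and "\<And>f f'. f \<in> B1_hom M N \<Longrightarrow> f' \<in> B1_hom M N \<Longrightarrow> \<forall>a\<in>A. f (\<iota> a) = g a \<Longrightarrow>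
      \<forall>a\<in>A. f' (\<iota> a) = g a \<Longrightarrow> f = f'" by blast+
qed

lemma B1_free_wrt_transfer:
  fixes j :: "'c \<Rightarrow> 'b"
  assumes free: "B1_free_wrt TYPE('b) M A \<iota>" and j: "inj j"
  shows "B1_free_wrt TYPE('c) M A \<iota>"
  unfolding B1_free_wrt_def
proof (intro conjI allI impI ballI)
  show M: "B1_module M" and \<iota>: "\<iota> \<in> A \<rightarrow> carrier M"
    using free by (auto simp: B1_free_wrt_def)
  interpret M: B1_module M by fact
  fix N :: "(B1, 'c) module" and g
  assume "B1_module N" and g: "g \<in> A \<rightarrow> carrier N"
  then interpret N: B1_module N by simp
  define i where "i = inv_into UNIV j"
  have ij [simp]: "i (j x) = x" for x using j by (simp add: i_def)
  define N' :: "(B1, 'b) module" where "N' = \<lparr>carrier = j ` carrier N, monoid.mult = undefined,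
    one = undefined, zero = j \<zero>\<^bsub>N\<^esub>, add = (\<lambda>x y. j (i x \<oplus>\<^bsub>N\<^esub> i y)),
    smult = (\<lambda>l x. j (l \<odot>\<^bsub>N\<^esub> i x))\<rparr>"
  have N': "B1_module N'"
    by (intro B1_module.intro B1_module_axioms.intro abelian_monoidI)
      (auto simp: N'_def N.smult_closed N.smult_l_distr N.smult_r_distr N.smult_one
        N.smult_zero N.a_ac)
  have j_hom: "(\<lambda>x\<in>carrier N. j x) \<in> B1_hom N N'"
    by (auto simp: B1_hom_def N'_def N.smult_closed)
  have i_hom: "(\<lambda>x\<in>carrier N'. i x) \<in> B1_hom N' N"
    by (auto simp: B1_hom_def N'_def N.smult_closed)
  have "\<exists>!f. f \<in> B1_hom M N' \<and> (\<forall>a\<in>A. f (\<iota> a) = j (g a))"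
  proof -
    have "(\<lambda>a. j (g a)) \<in> A \<rightarrow> carrier N'" using g by (auto simp: N'_def)
    then show ?thesis by (rule B1_free_wrt_ex1[OF free N'])
  qed
  then obtain f where f: "f \<in> B1_hom M N'" "\<forall>a\<in>A. f (\<iota> a) = j (g a)"
    and uniq: "\<And>f'. f' \<in> B1_hom M N' \<Longrightarrow> \<forall>a\<in>A. f' (\<iota> a) = j (g a) \<Longrightarrow> f' = f"
    by blast
  let ?h = "compose (carrier M) (\<lambda>x\<in>carrier N'. i x) f"
  show "\<exists>!f. f \<in> B1_hom M N \<and> (\<forall>a\<in>A. f (\<iota> a) = g a)"
  proof (rule ex1I[of _ ?h], intro conjI ballI)
    show "?h \<in> B1_hom M N" by (rule B1_hom_compose[OF M f(1) i_hom])
    show "?h (\<iota> a) = g a" if "a \<in> A" for a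
      using that \<iota> f g by (auto simp: compose_def N'_def)
  next
    fix h assume h: "h \<in> B1_hom M N \<and> (\<forall>a\<in>A. h (\<iota> a) = g a)"
    then have hc: "x \<in> carrier M \<Longrightarrow> h x \<in> carrier N" for x by (auto simp: B1_hom_def)
    let ?jh = "compose (carrier M) (\<lambda>x\<in>carrier N. j x) h"
    have "?jh = f"
    proof (rule uniq)
      show "?jh \<in> B1_hom M N'" using h by (intro B1_hom_compose[OF M _ j_hom]) simp
      show "\<forall>a\<in>A. ?jh (\<iota> a) = j (g a)" using h \<iota> g by (auto simp: compose_def)
    qed
    then have jh: "f x = j (h x)" if "x \<in> carrier M" for x
      using that hc by (auto simp: compose_def)
    have "h \<in> extensional (carrier M)" using h by (auto simp: B1_hom_def PiE_def)
    moreover have "h x = ?h x" if "x \<in> carrier M" for x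
      using that hc jh by (simp add: compose_def N'_def)
    ultimately show "h = ?h" by (intro extensionalityI[of _ "carrier M"]) auto
  qed
qed

theorem B1_free_wrt_any_type:
  fixes M :: "(B1, 'm) module" and A :: "'a set"
  assumes A: "finite A" and free: "B1_free M A \<iota>"
  shows "B1_free_wrt TYPE('b) M A \<iota>"
proof -
  have freeP: "B1_free_wrt TYPE('a set) M A \<iota>" and freeM: "B1_free_wrt TYPE('m) M A \<iota>"
    using free B1_free_wrt_transfer[of M A \<iota> "Inl :: 'a set \<Rightarrow> 'a set + 'm"]
      B1_free_wrt_transfer[of M A \<iota> "Inr :: 'm \<Rightarrow> 'a set + 'm"]
    by (auto simp: B1_free_def)
  have M: "B1_module M" and \<iota>: "\<iota> \<in> A \<rightarrow> carrier M"
    using free by (auto simp: B1_free_def B1_free_wrt_def)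
  let ?P = "B1_Pow A"
  have sing: "(\<lambda>a. {a}) \<in> A \<rightarrow> carrier ?P" by (auto simp: B1_Pow_def)
  obtain h where h: "h \<in> B1_hom ?P M" "\<forall>a\<in>A. h {a} = \<iota> a"
    using B1_free_wrtD(1)[OF B1_free_wrt_Pow[OF A] M \<iota>] by auto
  obtain k where k: "k \<in> B1_hom M ?P" "\<forall>a\<in>A. k (\<iota> a) = {a}"
    using B1_free_wrtD(1)[OF freeP B1_module_Pow sing] by auto
  have hk: "compose (carrier M) h k = (\<lambda>x\<in>carrier M. x)"
    by (rule B1_free_wrtD(2)[OF freeM M \<iota>])
      (use B1_hom_compose[OF M k(1) h(1)] B1_hom_id[OF M] h k \<iota> in \<open>auto simp: compose_def\<close>)
  have kc: "x \<in> carrier M \<Longrightarrow> k x \<in> carrier ?P" for x using k by (auto simp: B1_hom_def)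
  have hk': "h (k x) = x" if "x \<in> carrier M" for x
    using fun_cong[OF hk, of x] that by (simp add: compose_def)
  show ?thesis
    unfolding B1_free_wrt_def
  proof (intro conjI allI impI ballI M \<iota>)
    fix N :: "(B1, 'b) module" and g
    assume N: "B1_module N" and g: "g \<in> A \<rightarrow> carrier N"
    obtain f where f: "f \<in> B1_hom ?P N" "\<forall>a\<in>A. f {a} = g a"
      and uniq: "\<And>f'. f' \<in> B1_hom ?P N \<Longrightarrow> \<forall>a\<in>A. f' {a} = g a \<Longrightarrow> f' = f"
      using B1_free_wrtD[OF B1_free_wrt_Pow[OF A] N g] by blast
    let ?f = "compose (carrier M) f k"
    show "\<exists>!f. f \<in> B1_hom M N \<and> (\<forall>a\<in>A. f (\<iota> a) = g a)"
    proof (rule ex1I[of _ ?f], intro conjI ballI)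
      show "?f \<in> B1_hom M N" by (rule B1_hom_compose[OF M k(1) f(1)])
      show "?f (\<iota> a) = g a" if "a \<in> A" for a
        using that \<iota> k f by (auto simp: compose_def)
    next
      fix u assume u: "u \<in> B1_hom M N \<and> (\<forall>a\<in>A. u (\<iota> a) = g a)"
      have "compose (carrier ?P) u h = f"
      proof (rule uniq)
        show "compose (carrier ?P) u h \<in> B1_hom ?P N"
          using u by (intro B1_hom_compose[OF B1_module_Pow h(1)]) simp
        show "\<forall>a\<in>A. compose (carrier ?P) u h {a} = g a"
          using u h by (auto simp: compose_def B1_Pow_def)
      qed
      then have "f (k x) = u x" if "x \<in> carrier M" for x
        using that kc[OF that] hk'[OF that] by (auto simp: compose_def)
      moreover have "u \<in> extensional (carrier M)" using u by (auto simp: B1_hom_def PiE_def)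
      ultimately show "u = ?f"
        by (intro extensionalityI[of _ "carrier M"]) (auto simp: compose_def)
    qed
  qed
qed

end

theory Submission
  imports Defs
begin

text \<open>
  By uniqueness of free modules, \<open>M\<close> is isomorphic to \<open>\<P>({1..n})\<close>. An additive bijection of a
  power set onto itself preserves inclusion in both directions, hence permutes the minimal nonempty
  sets, that is, the singletons; so it is the direct image map of a permutation.
\<close>

text \<open>The restriction to \<open>Pow S\<close> is there because \<open>B1_hom\<close> contains
  only extensional functions.\<close>

definition B1_image :: "'a set \<Rightarrow> ('a \<Rightarrow> 'b) \<Rightarrow> 'a set \<Rightarrow> 'b set" where
  "B1_image S p = (\<lambda>X\<in>Pow S. p ` X)"

lemma B1_image_hom: "p \<in> S \<rightarrow> T \<Longrightarrow> B1_image S p \<in> B1_hom (B1_Pow S) (B1_Pow T)"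
  by (auto simp: B1_hom_def B1_Pow_def B1_image_def)

lemma carrier_B1_Pow [simp]: "carrier (B1_Pow A) = Pow A"
  by (simp add: B1_Pow_def)

lemma B1_hom_closed: "f \<in> B1_hom M N \<Longrightarrow> x \<in> carrier M \<Longrightarrow> f x \<in> carrier N"
  by (auto simp: B1_hom_def)

lemma B1_hom_eqI:
  assumes "f \<in> B1_hom M N" "g \<in> B1_hom M N" "\<And>x. x \<in> carrier M \<Longrightarrow> f x = g x"
  shows "f = g"
  using assms by (intro extensionalityI[of f "carrier M" g]) (auto simp: B1_hom_def PiE_def)

text \<open>An isomorphism of modules with both directions named, since automorphisms are later
  conjugated by \<open>k\<close> and \<open>h\<close>. Equations on elements spare the restricted
  identities that an equality of composites would involve.\<close>

definition B1_inverse_homs ::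
    "(B1, 'm) module \<Rightarrow> (B1, 'b) module \<Rightarrow> ('m \<Rightarrow> 'b) \<Rightarrow> ('b \<Rightarrow> 'm) \<Rightarrow> bool" where
  "B1_inverse_homs M N k h \<longleftrightarrow> k \<in> B1_hom M N \<and> h \<in> B1_hom N M \<and>
     (\<forall>x\<in>carrier M. h (k x) = x) \<and> (\<forall>y\<in>carrier N. k (h y) = y)"

lemma B1_inverse_homs_compose:
  assumes M: "B1_module M" and P: "B1_module P"
    and "B1_inverse_homs M N k h" and "B1_inverse_homs N P k' h'"
  shows "B1_inverse_homs M P (compose (carrier M) k' k) (compose (carrier P) h h')"
  using assms(3,4) B1_hom_compose[OF M, of k N k' P] B1_hom_compose[OF P, of h' N h M]
  by (auto simp: B1_inverse_homs_def compose_def B1_hom_closed)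

text \<open>Uniqueness of free objects: \<open>M\<close> and the power set share the universal
  property over \<open>A\<close>, so the morphisms matching up their generators are mutually
  inverse.\<close>

lemma B1_free_inverse_homs_Pow:
  fixes M :: "(B1, 'm) module" and A :: "'a set"
  assumes A: "finite A" and free: "B1_free M A \<iota>"
  obtains k h where "B1_inverse_homs M (B1_Pow A) k h"
proof -
  let ?P = "B1_Pow A"
  \<comment> \<open>\<open>B1_free\<close> tests only modules over one sum type; the targets here
    are \<open>?P\<close> and \<open>M\<close>, with elements of types \<open>'a set\<close> and
    \<open>'m\<close>.\<close>
  note freeP = B1_free_wrt_any_type[OF A free, where 'b = "'a set"]
  note freeM = B1_free_wrt_any_type[OF A free, where 'b = 'm]
  have M: "B1_module M" and \<iota>: "\<iota> \<in> A \<rightarrow> carrier M"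
    using freeM by (auto simp: B1_free_wrt_def)
  have sing: "(\<lambda>a. {a}) \<in> A \<rightarrow> carrier ?P" by auto
  obtain h where h: "h \<in> B1_hom ?P M" "\<forall>a\<in>A. h {a} = \<iota> a"
    using B1_free_wrtD(1)[OF B1_free_wrt_Pow[OF A] M \<iota>] by auto
  obtain k where k: "k \<in> B1_hom M ?P" "\<forall>a\<in>A. k (\<iota> a) = {a}"
    using B1_free_wrtD(1)[OF freeP B1_module_Pow sing] by auto
  \<comment> \<open>The composite and the identity are endomorphisms that agree on the generators
    \<open>\<iota> a\<close>, hence are equal.\<close>
  have "compose (carrier M) h k = (\<lambda>x\<in>carrier M. x)"
    by (rule B1_free_wrtD(2)[OF freeM M \<iota>])
      (use B1_hom_compose[OF M k(1) h(1)] B1_hom_id[OF M] h k \<iota> in \<open>auto simp: compose_def\<close>)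
  then have "h (k x) = x" if "x \<in> carrier M" for x
    using that by (metis compose_eq restrict_apply')
  moreover have "compose (carrier ?P) k h = (\<lambda>X\<in>carrier ?P. X)"
    by (rule B1_free_wrtD(2)[OF B1_free_wrt_Pow[OF A] B1_module_Pow sing])
      (use B1_hom_compose[OF B1_module_Pow h(1) k(1)] B1_hom_id[OF B1_module_Pow] h k
        in \<open>auto simp: compose_def\<close>)
  then have "k (h X) = X" if "X \<in> carrier ?P" for X
    using that by (metis compose_eq restrict_apply')
  ultimately have "B1_inverse_homs M ?P k h" using h k by (simp add: B1_inverse_homs_def)
  then show ?thesis by (rule that)
qed

text \<open>Relabelling of generators, by which \<open>A\<close> gives way to the letters
  \<open>{1..n}\<close> of \<open>sym_group n\<close>.\<close>

lemma B1_inverse_homs_image: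
  assumes "bij_betw b S T"
  shows "B1_inverse_homs (B1_Pow S) (B1_Pow T) (B1_image S b) (B1_image T (inv_into S b))"
proof -
  have "b \<in> S \<rightarrow> T" "inv_into S b \<in> T \<rightarrow> S"
    using assms by (auto simp: bij_betw_imp_funcset bij_betw_inv_into)
  moreover have "inv_into S b ` b ` X = X" if "X \<subseteq> S" for X
    using assms that by (simp add: bij_betw_def)
  moreover have "b ` inv_into S b ` Y = Y" if "Y \<subseteq> T" for Y
    using assms that by (simp add: bij_betw_def image_inv_into_cancel)
  ultimately show ?thesis
    using B1_image_hom[of b S T] B1_image_hom[of "inv_into S b" T S]
    by (auto simp: B1_inverse_homs_def B1_image_def)
qed

lemma additive_bij_Pow_is_image:
  assumes bij: "bij_betw F (Pow S) (Pow S)"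
    and un: "\<And>X Y. X \<subseteq> S \<Longrightarrow> Y \<subseteq> S \<Longrightarrow> F (X \<union> Y) = F X \<union> F Y"
  obtains p where "p permutes S" "\<And>X. X \<subseteq> S \<Longrightarrow> F X = p ` X"
proof -
  have inj: "F X = F Y \<longleftrightarrow> X = Y" if "X \<subseteq> S" "Y \<subseteq> S" for X Y
    using bij that by (auto simp: bij_betw_def inj_on_eq_iff)
  \<comment> \<open>Union encodes inclusion: \<open>X \<subseteq> Y\<close> means
    \<open>X \<union> Y = Y\<close>, which \<open>F\<close> preserves by additivity and reflects by
    injectivity.\<close>
  have mono: "F X \<subseteq> F Y \<longleftrightarrow> X \<subseteq> Y" if "X \<subseteq> S" "Y \<subseteq> S" for X Y
    using un[OF that] inj[of "X \<union> Y" Y] that by (metis Un_subset_iff subset_Un_eq)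
  have sub: "F X \<subseteq> S" if "X \<subseteq> S" for X
    using bij that by (auto simp: bij_betw_def)
  have surj: "\<exists>Z\<subseteq>S. F Z = Y" if "Y \<subseteq> S" for Y
    using bij_betw_imp_surj_on[OF bij] that by (metis PowD PowI imageE)
  \<comment> \<open>Additivity alone does not mention the zero element; instead, the empty set lies
    below the preimage of \<open>{}\<close>.\<close>
  have empty: "F {} = {}" using surj[of "{}"] mono[of "{}"] by auto
  have "\<exists>c. F {a} = {c}" if a: "a \<in> S" for a
  proof -
    have "F {a} \<noteq> {}" using inj[of "{a}" "{}"] a empty by auto
    then obtain c where c: "c \<in> F {a}" by blast
    \<comment> \<open>The preimage of the smaller set \<open>{c}\<close> is nonempty and lies below
      \<open>{a}\<close>, so it is \<open>{a}\<close> itself.\<close>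
    then obtain Z where Z: "Z \<subseteq> S" "F Z = {c}" using surj[of "{c}"] sub[of "{a}"] a by blast
    then have "Z \<subseteq> {a}" using mono[of Z "{a}"] a c by simp
    moreover have "Z \<noteq> {}" using Z empty by auto
    ultimately have "Z = {a}" by blast
    then show ?thesis using Z by auto
  qed
  then obtain q where q: "\<And>a. a \<in> S \<Longrightarrow> F {a} = {q a}" by metis
  \<comment> \<open>\<open>permutes\<close> demands the identity outside \<open>S\<close>, where
    \<open>q\<close> is arbitrary.\<close>
  define p where "p a = (if a \<in> S then q a else a)" for a
  have p: "F {a} = {p a}" if "a \<in> S" for a using that q by (simp add: p_def)
  have pS: "p a \<in> S" if "a \<in> S" for a using p[OF that] sub[of "{a}"] that by auto
  have onto: "\<exists>a\<in>S. p a = c" if "c \<in> S" for c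
  proof -
    have "{c} \<subseteq> S" using that by simp
    from surj[OF this] obtain Z where Z: "Z \<subseteq> S" "F Z = {c}" by blast
    then have "Z \<noteq> {}" using empty by auto
    then obtain a where a: "a \<in> Z" by blast
    then have "a \<in> S" using Z by blast
    moreover have "F {a} \<subseteq> {c}" using mono[of "{a}" Z] Z a \<open>a \<in> S\<close> by simp
    ultimately show ?thesis using p[of a] by simp blast
  qed
  have "inj_on p S"
  proof (rule inj_onI)
    fix a b assume "a \<in> S" "b \<in> S" "p a = p b"
    then show "a = b" using p[of a] p[of b] inj[of "{a}" "{b}"] by simp
  qed
  then have "bij_betw p S S" using pS onto by (fastforce simp: bij_betw_def)
  then have "p permutes S" by (rule bij_imp_permutes) (simp add: p_def)
  moreover have "F X = p ` X" if X: "X \<subseteq> S" for X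
  proof -
    \<comment> \<open>Membership is inclusion of a singleton: \<open>p a \<in> F X\<close> says
      \<open>F {a} \<subseteq> F X\<close>.\<close>
    have iff: "p a \<in> F X \<longleftrightarrow> a \<in> X" if "a \<in> S" for a
      using mono[of "{a}" X] that X p by simp
    show ?thesis
    proof (intro equalityI subsetI)
      fix c assume c: "c \<in> F X"
      then obtain a where "a \<in> S" "p a = c" using onto sub[OF X] by blast
      then show "c \<in> p ` X" using iff c by auto
    next
      fix c assume "c \<in> p ` X"
      then show "c \<in> F X" using iff X by auto
    qed
  qed
  ultimately show ?thesis using that by blast
qed

text \<open>A permutation acts on \<open>M\<close> by passing to subsets through \<open>k\<close>,
  taking direct images and returning through \<open>h\<close>. Direct images respect composition,
  and the inverse permutation supplies the inverse automorphism.\<close>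

lemma B1_inverse_homs_iso_sym_group:
  fixes M :: "(B1, 'm) module"
  assumes M: "B1_module M" and "B1_inverse_homs M (B1_Pow {1..n}) k h"
  shows "(\<lambda>p. compose (carrier M) h (compose (carrier M) (B1_image {1..n} p) k))
    \<in> iso (sym_group n) (B1_Aut M)"
proof -
  define S where "S = {1..n}"
  let ?P = "B1_Pow S"
  have k: "k \<in> B1_hom M ?P" and h: "h \<in> B1_hom ?P M"
    and hk: "x \<in> carrier M \<Longrightarrow> h (k x) = x" and kh: "X \<subseteq> S \<Longrightarrow> k (h X) = X" for x X
    using assms(2) by (auto simp: B1_inverse_homs_def S_def)
  have kc: "x \<in> carrier M \<Longrightarrow> k x \<subseteq> S" and hc: "X \<subseteq> S \<Longrightarrow> h X \<in> carrier M" for x X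
    using B1_hom_closed[OF k] B1_hom_closed[OF h] by auto
  let ?\<Phi> = "\<lambda>p. compose (carrier M) h (compose (carrier M) (B1_image S p) k)"
  have \<Phi>_app: "?\<Phi> p x = h (p ` k x)" if "x \<in> carrier M" for p x
    using that kc by (simp add: compose_def B1_image_def)
  have im: "p ` X \<subseteq> S" if "p permutes S" "X \<subseteq> S" for p X
    using that permutes_image[of p S] by blast
  have \<Phi>_hom: "?\<Phi> p \<in> B1_hom M M" if "p permutes S" for p
    using B1_hom_compose[OF M B1_hom_compose[OF M k B1_image_hom] h] permutes_imp_bij[OF that]
    by (simp add: bij_betw_imp_funcset)
  have \<Phi>_inv: "?\<Phi> (inv' p) (?\<Phi> p x) = x" "?\<Phi> p (?\<Phi> (inv' p) x) = x"
    if "p permutes S" "x \<in> carrier M" for p x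
    using that by (simp_all add: \<Phi>_app hc kc kh hk im permutes_inv image_comp permutes_inv_o)
  have \<Phi>_Bij: "?\<Phi> p \<in> Bij (carrier M)" if p: "p permutes S" for p
  proof -
    have "bij_betw (?\<Phi> p) (carrier M) (carrier M)"
      using \<Phi>_inv[OF p] B1_hom_closed[OF \<Phi>_hom[OF p]] B1_hom_closed[OF \<Phi>_hom[OF permutes_inv[OF p]]]
      by (intro bij_betw_byWitness[where f' = "?\<Phi> (inv' p)"]) blast+
    then show ?thesis by (simp add: Bij_def compose_def)
  qed
  have \<Phi>_mult: "?\<Phi> (p \<circ> q) = ?\<Phi> p \<otimes>\<^bsub>B1_Aut M\<^esub> ?\<Phi> q" if p: "p permutes S" and q: "q permutes S" for p q
  proof -
    have "?\<Phi> (p \<circ> q) = compose (carrier M) (?\<Phi> p) (?\<Phi> q)"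
      using p q
      by (intro B1_hom_eqI[OF \<Phi>_hom B1_hom_compose[OF M \<Phi>_hom \<Phi>_hom]] permutes_compose)
        (simp_all add: compose_eq[of _ "carrier M" "?\<Phi> p" "?\<Phi> q"] \<Phi>_app hc kc kh im image_comp)
    then show ?thesis using \<Phi>_Bij[OF p] \<Phi>_Bij[OF q] by (simp add: B1_Aut_def BijGroup_def)
  qed
  have \<Phi>_inj: "p = q" if p: "p permutes S" and q: "q permutes S" and eq: "?\<Phi> p = ?\<Phi> q" for p q
  proof
    fix a
    show "p a = q a"
    proof (cases "a \<in> S")
      case True
      \<comment> \<open>The element \<open>h {a}\<close> is the generator of \<open>M\<close> that
        corresponds to \<open>a\<close>, so its image reveals \<open>p a\<close>.\<close>
      then have "h (p ` {a}) = h (q ` {a})"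
        using fun_cong[OF eq, of "h {a}"] by (simp only: \<Phi>_app hc kh empty_subsetI insert_subset simp_thms)
      then have "p ` {a} = q ` {a}" using True p q by (metis im kh empty_subsetI insert_subset)
      then show ?thesis by simp
    next
      case False
      then show ?thesis using p q by (metis permutes_not_in)
    qed
  qed
  have \<Phi>_surj: "\<exists>p. p permutes S \<and> f = ?\<Phi> p" if "f \<in> B1_hom M M" "f \<in> Bij (carrier M)" for f
  proof -
    \<comment> \<open>Conjugation moves \<open>f\<close> to an additive bijection of
      \<open>Pow S\<close>, to which \<open>additive_bij_Pow_is_image\<close> applies.\<close>
    let ?F = "\<lambda>X. k (f (h X))"
    have fc: "x \<in> carrier M \<Longrightarrow> f x \<in> carrier M" for x by (rule B1_hom_closed[OF that(1)])
    have "bij_betw k (carrier M) (Pow S)"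
      by (rule bij_betw_byWitness[where f' = h]) (use kc hc hk kh in auto)
    moreover have "bij_betw h (Pow S) (carrier M)"
      by (rule bij_betw_byWitness[where f' = k]) (use kc hc hk kh in auto)
    moreover have "bij_betw f (carrier M) (carrier M)" using that by (simp add: Bij_def)
    ultimately have "bij_betw (k \<circ> (f \<circ> h)) (Pow S) (Pow S)"
      by (meson bij_betw_trans)
    then have bij: "bij_betw ?F (Pow S) (Pow S)" by (simp add: comp_def)
    have "?F (X \<union> Y) = ?F X \<union> ?F Y" if "X \<subseteq> S" "Y \<subseteq> S" for X Y
      using k h \<open>f \<in> B1_hom M M\<close> fc hc that by (simp add: B1_hom_def B1_Pow_def)
    then obtain p where p: "p permutes S" "\<And>X. X \<subseteq> S \<Longrightarrow> ?F X = p ` X"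
      using additive_bij_Pow_is_image[OF bij] by metis
    \<comment> \<open>For \<open>X = k x\<close> the formula for \<open>?F\<close> identifies
      \<open>k (f x)\<close> with the image of \<open>k x\<close> under \<open>p\<close>; applying
      \<open>h\<close> recovers \<open>f x\<close>.\<close>
    have "f x = ?\<Phi> p x" if "x \<in> carrier M" for x
      using p(2)[OF kc[OF that]] that fc by (simp only: \<Phi>_app) (metis hk)
    then have "f = ?\<Phi> p" by (rule B1_hom_eqI[OF that(1) \<Phi>_hom[OF p(1)]])
    then show ?thesis using p by blast
  qed
  have carrier_sym: "carrier (sym_group n) = {p. p permutes S}"
    by (simp add: sym_group_def S_def)
  have carrier_Aut: "carrier (B1_Aut M) = B1_hom M M \<inter> Bij (carrier M)"
    by (simp add: B1_Aut_def)
  have "?\<Phi> \<in> hom (sym_group n) (B1_Aut M)"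
    by (rule homI) (use \<Phi>_hom \<Phi>_Bij \<Phi>_mult in \<open>simp_all add: carrier_sym carrier_Aut sym_group_mult\<close>)
  moreover have "inj_on ?\<Phi> (carrier (sym_group n))"
    by (rule inj_onI) (use \<Phi>_inj in \<open>simp add: carrier_sym\<close>)
  moreover have "?\<Phi> ` carrier (sym_group n) = carrier (B1_Aut M)"
    unfolding carrier_sym carrier_Aut
  proof (intro equalityI subsetI)
    fix f assume "f \<in> B1_hom M M \<inter> Bij (carrier M)"
    then obtain p where "p permutes S" "f = ?\<Phi> p" using \<Phi>_surj by blast
    then show "f \<in> ?\<Phi> ` {p. p permutes S}" by (intro image_eqI[of f ?\<Phi> p]) simp_all
  qed (use \<Phi>_hom \<Phi>_Bij in blast)
  ultimately show ?thesis
    unfolding S_def by (simp add: iso_def bij_betw_def)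
qed

theorem mainTheorem4:
  fixes n :: nat and M :: "(B1, 'm) module" and A :: "'a set" and \<iota> :: "'a \<Rightarrow> 'm"
  assumes "finite A" and "card A = n"
    and "B1_free M A \<iota>"
  shows "B1_Aut M \<cong> sym_group n"
proof -
  have M: "B1_module M" using assms(3) by (simp add: B1_free_def B1_free_wrt_def)
  obtain k h where "B1_inverse_homs M (B1_Pow A) k h"
    using B1_free_inverse_homs_Pow[OF assms(1,3)] .
  moreover obtain b where "bij_betw b A {1..n}"
    using finite_same_card_bij[OF assms(1), of "{1..n}"] assms(2) by auto
  ultimately obtain k' h' where "B1_inverse_homs M (B1_Pow {1..n}) k' h'"
    using B1_inverse_homs_compose[OF M B1_module_Pow _ B1_inverse_homs_image] by blast
  then have "sym_group n \<cong> B1_Aut M"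
    using B1_inverse_homs_iso_sym_group[OF M] unfolding is_iso_def by blast
  \<comment> \<open>The explicit map starts from permutations, so the isomorphism has to be
    reversed.\<close>
  then show ?thesis by (rule group.iso_sym[OF sym_group_is_group])
qed

end
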